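(* Let $T[1..n]$ be a text and let $\bar{r}$ be the number of runs in the Burrows-Wheeler Transform (BWT) of the reverse of $T$. The set of positions in $T$ of the (at most $2\bar{r}$) characters at run boundaries in the BWT of the reverse of $T$ is a suffixient set for $T$.
   Context: Text. $T[1..n]$ ends with a special character $\$ = T[n]$ that occurs nowhere else in $T$ and is smaller than all other characters. Suffix tree. The compacted trie of the suffixes of $T$. The path label of a node is the concatenation of the edge labels on the path from the root to that node. Suffixient set. A set $S \subseteq \{1, \ldots, n\}$ is suffixient for $T$ if, for any edge descending from a node $u$ to a node $v$ in the suffix tree of $T$, there is an element $s \in S$ such that $u$'s path label is a suffix of $T[1..s-1]$ and $T[s]$ is the first character of the label of the edge $(u,v)$. BWT of the reverse of $T$. Sort the positions $s \in \{1, \ldots, n\}$ by the co-lexicographic order of the prefixes $T[1..s-1]$ (i.e., by the lexicographic order of their reverses, the empty prefix being first), giving a sequence $s_1, \ldots, s_n$. The BWT of the reverse of $T$ is the string $T[s_1] T[s_2] \cdots T[s_n]$, and the position in $T$ of its $k$th character is $s_k$. A run is a maximal non-empty block of consecutive equal characters in this string. A character of the BWT is at a run boundary if it is the first or the last character of its run. *)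

theory Defs
  imports Main "HOL-Library.Sublist" "HOL-Library.List_Lexorder"
begin

text \<open>
  Positions in a text are numbered from 1, as in \<open>T[1..n]\<close>, whereas list indices start at 0.
\<close>

definition char_at :: "'a list \<Rightarrow> nat \<Rightarrow> 'a" where
  "char_at T i = T ! (i - 1)"

definition terminated :: "'a::linorder list \<Rightarrow> bool" where
  "terminated T \<longleftrightarrow> T \<noteq> [] \<and> last T \<notin> set (butlast T) \<and>
     (\<forall>c \<in> set T. c \<noteq> last T \<longrightarrow> last T < c)"

text \<open>
  A node of the trie of a set of strings is represented by the string spelled from the root
  to it; its children are its one-letter extensions in the trie. Compaction contracts every
  node with exactly one child, except the root. No suffix of a terminated text is a proper
  prefix of another one, so every suffix remains a leaf.
\<close>

definition trie_nodes :: "'a list set \<Rightarrow> 'a list set" where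
  "trie_nodes L = {w. \<exists>x \<in> L. prefix w x}"

definition ctrie_nodes :: "'a list set \<Rightarrow> 'a list set" where
  "ctrie_nodes L = {w \<in> trie_nodes L. w = [] \<or> \<not> (\<exists>!c. w @ [c] \<in> trie_nodes L)}"

text \<open>\<open>ctrie_edge L u e v\<close>: an edge labelled \<open>e\<close> descends from \<open>u\<close> to \<open>v\<close>.\<close>

definition ctrie_edge :: "'a list set \<Rightarrow> 'a list \<Rightarrow> 'a list \<Rightarrow> 'a list \<Rightarrow> bool" where
  "ctrie_edge L u e v \<longleftrightarrow> u \<in> ctrie_nodes L \<and> v \<in> ctrie_nodes L \<and> e \<noteq> [] \<and> v = u @ e \<and>
     \<not> (\<exists>w \<in> ctrie_nodes L. strict_prefix u w \<and> strict_prefix w v)"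

inductive ctrie_path_label :: "'a list set \<Rightarrow> 'a list \<Rightarrow> 'a list \<Rightarrow> bool"
  for L :: "'a list set" where
  root: "ctrie_path_label L [] []"
| edge: "ctrie_path_label L u p \<Longrightarrow> ctrie_edge L u e v \<Longrightarrow> ctrie_path_label L v (p @ e)"

definition text_suffixes :: "'a list \<Rightarrow> 'a list set" where
  "text_suffixes T = {x. suffix x T \<and> x \<noteq> []}"

abbreviation suffix_tree_edge :: "'a list \<Rightarrow> 'a list \<Rightarrow> 'a list \<Rightarrow> 'a list \<Rightarrow> bool" where
  "suffix_tree_edge T \<equiv> ctrie_edge (text_suffixes T)"

abbreviation suffix_tree_path_label :: "'a list \<Rightarrow> 'a list \<Rightarrow> 'a list \<Rightarrow> bool" where
  "suffix_tree_path_label T \<equiv> ctrie_path_label (text_suffixes T)"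

definition suffixient :: "'a list \<Rightarrow> nat set \<Rightarrow> bool" where
  "suffixient T S \<longleftrightarrow> S \<subseteq> {1..length T} \<and>
     (\<forall>u e v p. suffix_tree_edge T u e v \<longrightarrow> suffix_tree_path_label T u p \<longrightarrow>
        (\<exists>s \<in> S. suffix p (take (s - 1) T) \<and> char_at T s = hd e))"

text \<open>
  The order on lists is the lexicographic one, in which a proper prefix is smaller. The keys
  are pairwise distinct, having distinct lengths.
\<close>

definition colex_positions :: "'a::linorder list \<Rightarrow> nat list" where
  "colex_positions T = sort_key (\<lambda>s. rev (take (s - 1) T)) [1..<length T + 1]"

definition bwt_rev :: "'a::linorder list \<Rightarrow> 'a list" where
  "bwt_rev T = map (char_at T) (colex_positions T)"

text \<open>Blocks and runs are given by the (0-based) indices of their first and last characters.\<close>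

definition equal_block :: "'a list \<Rightarrow> nat \<Rightarrow> nat \<Rightarrow> bool" where
  "equal_block w i j \<longleftrightarrow> i \<le> j \<and> j < length w \<and> (\<forall>k \<in> {i..j}. w ! k = w ! i)"

definition runs :: "'a list \<Rightarrow> (nat \<times> nat) set" where
  "runs w = {(i, j). equal_block w i j \<and>
     (\<forall>i' j'. equal_block w i' j' \<and> i' \<le> i \<and> j \<le> j' \<longrightarrow> i' = i \<and> j' = j)}"

definition at_run_boundary :: "'a list \<Rightarrow> nat \<Rightarrow> bool" where
  "at_run_boundary w k \<longleftrightarrow> (\<exists>(i, j) \<in> runs w. k = i \<or> k = j)"

definition run_boundary_positions :: "'a::linorder list \<Rightarrow> nat set" where
  "run_boundary_positions T = {colex_positions T ! k | k. at_run_boundary (bwt_rev T) k}"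

end

theory Submission
  imports Defs
begin

text \<open>
  In the co-lexicographic order the prefixes of the text that end with \<open>u\<close> are consecutive. If
  \<open>u\<close> is followed by \<open>c\<close> somewhere and by another character elsewhere, then a run of \<open>c\<close> that
  meets this block of prefixes does not cover it, so one end of the run lies in the block. If \<open>u\<close>
  is empty, the block is the whole transform and contains both ends of every run.
\<close>

text \<open>By induction on \<open>p\<close>: when \<open>x\<close> and \<open>z\<close> both start
  with \<open>a\<close>, \<open>y\<close> is nonempty because it is not below \<open>x\<close>, and
  its first letter is squeezed to \<open>a\<close>. The tails are then ordered in the same
  way.\<close>

lemma prefix_between:
  fixes p x y z :: "'a::linorder list"
  assumes "x \<le> y" "y \<le> z" "prefix p x" "prefix p z"
  shows "prefix p y"
  using assms
proof (induction p arbitrary: x y z)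
  case (Cons a p)
  obtain x' z' where xz: "x = a # x'" "z = a # z'" "prefix p x'" "prefix p z'"
    using Cons.prems(3,4) by (auto simp: prefix_def)
  with Cons.prems(1) obtain b y' where y: "y = b # y'"
    by (cases y) auto
  have "b = a" "x' \<le> y'" "y' \<le> z'"
    using Cons.prems(1,2) xz y by auto
  with Cons.IH xz y show ?case
    by auto
qed simp

text \<open>Each node is represented by the string spelled from the root, and each edge appends its
  label to that string.\<close>

lemma ctrie_path_label_eq: "ctrie_path_label L v p \<Longrightarrow> p = v"
  by (induction rule: ctrie_path_label.induct) (auto simp: ctrie_edge_def)

lemma trie_nodes_prefix: "w \<in> trie_nodes L \<Longrightarrow> prefix v w \<Longrightarrow> v \<in> trie_nodes L"
  unfolding trie_nodes_def by (blast intro: prefix_order.trans)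

text \<open>Compaction leaves no node other than the root with exactly one child. The edge supplies
  one child, so there is a second one; the root may have a single child, hence the premise on
  \<open>u\<close>.\<close>

lemma ctrie_edge_branching:
  assumes "ctrie_edge L u e v"
  shows "u @ [hd e] \<in> trie_nodes L"
    and "u \<noteq> [] \<Longrightarrow> \<exists>d. d \<noteq> hd e \<and> u @ [d] \<in> trie_nodes L"
proof -
  have "u @ e \<in> trie_nodes L" "e \<noteq> []" and u: "u \<in> ctrie_nodes L"
    using assms by (auto simp: ctrie_edge_def ctrie_nodes_def)
  moreover have "prefix (u @ [hd e]) (u @ e)"
    using \<open>e \<noteq> []\<close> by (cases e) auto
  ultimately show c: "u @ [hd e] \<in> trie_nodes L"
    by (blast intro: trie_nodes_prefix)
  show "\<exists>d. d \<noteq> hd e \<and> u @ [d] \<in> trie_nodes L" if "u \<noteq> []"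
    using u c that unfolding ctrie_nodes_def by (auto simp: Ex1_def)
qed

lemma length_colex_positions [simp]: "length (colex_positions T) = length T"
  by (simp add: colex_positions_def del: upt_Suc)

lemma set_colex_positions [simp]: "set (colex_positions T) = {1..length T}"
  by (auto simp: colex_positions_def)

lemma length_bwt_rev [simp]: "length (bwt_rev T) = length T"
  by (simp add: bwt_rev_def)

lemma colex_positions_nth_mono:
  assumes "i \<le> j" "j < length T"
  shows "rev (take (colex_positions T ! i - 1) T) \<le> rev (take (colex_positions T ! j - 1) T)"
proof -
  have "sorted (map (\<lambda>s. rev (take (s - 1) T)) (colex_positions T))"
    unfolding colex_positions_def by (rule sorted_sort_key)
  from sorted_nth_mono[OF this assms(1)] assms show ?thesis
    by simp
qed

text \<open>Reversal turns suffixes into prefixes and the co-lexicographic order into the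
  lexicographic one, so \<open>prefix_between\<close> applies: the prefixes ending with
  \<open>u\<close> form a contiguous block.\<close>

lemma suffix_colex_between:
  assumes "suffix u (take (colex_positions T ! i - 1) T)"
    and "suffix u (take (colex_positions T ! j - 1) T)"
    and "i \<le> k" "k \<le> j" "j < length T"
  shows "suffix u (take (colex_positions T ! k - 1) T)"
  using prefix_between[OF colex_positions_nth_mono[of i k T] colex_positions_nth_mono[of k j T]] assms
  by (simp add: suffix_to_prefix)

text \<open>Links the tree to the transform: an occurrence of \<open>u\<close> followed by
  \<open>c\<close> in the text shows up as an entry \<open>c\<close> within the block of
  \<open>u\<close>.\<close>

lemma text_factor_colex_index:
  assumes "u @ [c] \<in> trie_nodes (text_suffixes T)"
  obtains k where "k < length T" "suffix u (take (colex_positions T ! k - 1) T)"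
    and "bwt_rev T ! k = c"
proof -
  obtain a b where T: "T = a @ u @ [c] @ b"
    using assms by (auto simp: trie_nodes_def text_suffixes_def prefix_def suffix_def)
  \<comment> \<open>The 1-based position of the chosen \<open>c\<close>, so that the prefix before
    it is \<open>a @ u\<close>.\<close>
  define s where "s = Suc (length a + length u)"
  have "s \<in> set (colex_positions T)"
    by (simp add: s_def T)
  then obtain k where k: "k < length T" "colex_positions T ! k = s"
    by (metis in_set_conv_nth length_colex_positions)
  moreover have "take (s - 1) T = a @ u" "char_at T s = c"
    by (simp_all add: s_def T char_at_def nth_append)
  ultimately show ?thesis
    by (intro that[of k]) (simp_all add: bwt_rev_def suffix_def)
qed

lemma runs_bounds: "(i, j) \<in> runs w \<Longrightarrow> i \<le> j \<and> j < length w"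
  unfolding runs_def equal_block_def by blast

lemma runs_nth: "(i, j) \<in> runs w \<Longrightarrow> k \<in> {i..j} \<Longrightarrow> w ! k = w ! i"
  unfolding runs_def equal_block_def by blast

lemma finite_runs: "finite (runs w)"
  by (rule finite_subset[of _ "{..<length w} \<times> {..<length w}"]) (auto dest: runs_bounds)

text \<open>Only finitely many blocks contain \<open>k\<close>, and \<open>{k..k}\<close> is one of
  them, so some block containing \<open>k\<close> is maximal under inclusion.\<close>

lemma ex_run:
  assumes "k < length w"
  obtains i j where "(i, j) \<in> runs w" "k \<in> {i..j}"
proof -
  define A where "A = {{i..j} | i j. equal_block w i j \<and> k \<in> {i..j}}"
  have "A \<subseteq> Pow {..<length w}"
    by (auto simp: A_def equal_block_def)
  then have "finite A"
    by (rule finite_subset) simp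
  moreover have "{k..k} \<in> A"
    unfolding A_def using assms by (auto simp: equal_block_def intro!: exI[of _ k])
  ultimately obtain M where M: "M \<in> A" "\<forall>B \<in> A. M \<subseteq> B \<longrightarrow> M = B"
    using finite_has_maximal2[of A "{k..k}"] by blast
  then obtain i j where ij: "M = {i..j}" "equal_block w i j" "k \<in> {i..j}"
    by (auto simp: A_def)
  have "i' = i \<and> j' = j" if "equal_block w i' j'" "i' \<le> i" "j \<le> j'" for i' j'
  proof -
    have "{i'..j'} \<in> A" "M \<subseteq> {i'..j'}"
      using that ij by (auto simp: A_def)
    then have "{i..j} = {i'..j'}"
      using M(2) ij(1) by blast
    \<comment> \<open>Equal intervals have equal ends because they are nonempty: \<open>k\<close>
      lies in them.\<close>
    then show ?thesis
      using ij(3) by auto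
  qed
  then have "(i, j) \<in> runs w"
    using ij(2) unfolding runs_def by blast
  then show ?thesis
    using that ij(3) by blast
qed

text \<open>As a union indexed by runs, the set can be bounded in size by counting at most two
  positions per run.\<close>

lemma run_boundary_positions_eq:
  "run_boundary_positions T =
    (\<Union>(i, j) \<in> runs (bwt_rev T). {colex_positions T ! i, colex_positions T ! j})"
  unfolding run_boundary_positions_def at_run_boundary_def case_prod_unfold by blast

lemma run_boundary_positions_subset: "run_boundary_positions T \<subseteq> {1..length T}"
proof -
  have "colex_positions T ! k \<in> {1..length T}" if "k < length T" for k
    using nth_mem[of k "colex_positions T"] that by simp
  then show ?thesis
    unfolding run_boundary_positions_eq by (fastforce dest: runs_bounds)
qed

lemma card_run_boundary_positions:
  "card (run_boundary_positions T) \<le> 2 * card (runs (bwt_rev T))"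
proof -
  have "card (run_boundary_positions T) \<le>
      (\<Sum>(i, j) \<in> runs (bwt_rev T). card {colex_positions T ! i, colex_positions T ! j})"
    unfolding run_boundary_positions_eq
    using card_UN_le[OF finite_runs[of "bwt_rev T"],
        of "\<lambda>(i, j). {colex_positions T ! i, colex_positions T ! j}"]
    by (simp add: case_prod_unfold)
  also have "\<dots> \<le> (\<Sum>_ \<in> runs (bwt_rev T). 2)"
    by (rule sum_mono) (auto simp: card_insert_if)
  finally show ?thesis
    by simp
qed

lemma suffix_tree_edge_run_boundary:
  assumes edge: "suffix_tree_edge T u e v"
  shows "\<exists>s \<in> run_boundary_positions T. suffix u (take (s - 1) T) \<and> char_at T s = hd e"
proof -
  let ?w = "bwt_rev T"
  let ?block = "\<lambda>k. suffix u (take (colex_positions T ! k - 1) T)"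
  obtain k where k: "k < length T" "?block k" "?w ! k = hd e"
    using text_factor_colex_index[OF ctrie_edge_branching(1)[OF edge]] by blast
  obtain i j where run: "(i, j) \<in> runs ?w" and kij: "k \<in> {i..j}"
    using ex_run[of k ?w] k(1) by auto
  have ij: "i \<le> j" "j < length T"
    using runs_bounds[OF run] by simp_all
  have c: "?w ! m = hd e" if "m \<in> {i..j}" for m
    using runs_nth[OF run] that kij k(3) by metis
  have "?block i \<or> ?block j"
  proof (cases "u = []")
    case False
    then obtain d where d: "d \<noteq> hd e" "u @ [d] \<in> trie_nodes (text_suffixes T)"
      using ctrie_edge_branching(2)[OF edge] by blast
    obtain l where l: "l < length T" "?block l" "?w ! l = d"
      using text_factor_colex_index[OF d(2)] by blast
    \<comment> \<open>The whole run carries \<open>hd e\<close>, so \<open>l\<close> lies outside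
      it. The end of the run on the side of \<open>l\<close> is then between \<open>k\<close> and
      \<open>l\<close>, which both belong to the block of \<open>u\<close>.\<close>
    have "l < i \<or> j < l"
      using c[of l] d(1) l(3) by force
    then show ?thesis
      using suffix_colex_between[OF l(2) k(2), of i] suffix_colex_between[OF k(2) l(2), of j]
        kij k(1) l(1) by auto
  qed simp
  then obtain m where m: "m = i \<or> m = j" "?block m"
    by blast
  have "colex_positions T ! m \<in> run_boundary_positions T"
    using run m(1) unfolding run_boundary_positions_eq by blast
  moreover have "char_at T (colex_positions T ! m) = hd e"
    using c[of m] m(1) ij by (auto simp: bwt_rev_def)
  ultimately show ?thesis
    using m(2) by blast
qed

theorem lemma1:
  fixes T :: "'a::linorder list"
  assumes "terminated T"
  shows "suffixient T (run_boundary_positions T) \<and>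
    card (run_boundary_positions T) \<le> 2 * card (runs (bwt_rev T))"
proof
  show "suffixient T (run_boundary_positions T)"
    unfolding suffixient_def
  proof (intro conjI allI impI)
    fix u e v p
    assume edge: "suffix_tree_edge T u e v" and "suffix_tree_path_label T u p"
    then have "p = u"
      by (simp add: ctrie_path_label_eq)
    then show "\<exists>s \<in> run_boundary_positions T. suffix p (take (s - 1) T) \<and> char_at T s = hd e"
      using suffix_tree_edge_run_boundary[OF edge] by simp
  qed (rule run_boundary_positions_subset)
qed (rule card_run_boundary_positions)

end
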